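(* Let $P_{i}, Q_{i}\subset\mathbb{R}^{d_{i}}$, $i=1,\ldots,l$, be $0$-symmetric convex bodies. If $$Q\in\mathcal{B}_{P_{1},\ldots,P_{l}}\left(\otimes_{i=1}^{l}\mathbb{R}^{d_{i}}\right)\cap\mathcal{B}_{Q_{1},\ldots,Q_{l}}\left(\otimes_{i=1}^{l}\mathbb{R}^{d_{i}}\right),$$ then there exist real numbers $\lambda_{i}>0$, $i=1,\ldots,l$, such that $\lambda_{1}\cdots\lambda_{l}=1$ and $P_{i}=\lambda_{i}Q_{i}$ for $i=1,\ldots,l$.
   Context: Here $l$ and $d_1,\dots,d_l$ are positive integers. $\langle\cdot,\cdot\rangle$ is the standard scalar product on $\mathbb{R}^{d}$, and $\langle\cdot,\cdot\rangle_H$ is the scalar product on $\otimes_{i=1}^l\mathbb{R}^{d_i}$ determined by $\langle x^1\otimes\cdots\otimes x^l,y^1\otimes\cdots\otimes y^l\rangle_H=\prod_{i=1}^l\langle x^i,y^i\rangle$. In a Euclidean space $\mathbb{E}$, a convex body is a compact convex set with nonempty interior; it is $0$-symmetric if $P=-P$. The polar set of a nonempty $C\subset\mathbb{E}$ is $C^\circ=\{y\in\mathbb{E}:\sup_{x\in C}|\langle x,y\rangle_{\mathbb{E}}|\le 1\}$ (with $\langle\cdot,\cdot\rangle$ in $\mathbb{R}^{d_i}$ and $\langle\cdot,\cdot\rangle_H$ in the tensor product). For $0$-symmetric convex bodies $Q_i\subset\mathbb{R}^{d_i}$: $Q_1\otimes_\pi\cdots\otimes_\pi Q_l:=\mathrm{conv}\{x^1\otimes\cdots\otimes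 x^l:x^i\in Q_i,\ i=1,\dots,l\}$ and $Q_1\otimes_\epsilon\cdots\otimes_\epsilon Q_l:=(Q_1^\circ\otimes_\pi\cdots\otimes_\pi Q_l^\circ)^\circ$. The set $\mathcal{B}_{Q_1,\ldots,Q_l}(\otimes_{i=1}^l\mathbb{R}^{d_i})$ consists of the $0$-symmetric convex bodies $Q\subset\otimes_{i=1}^l\mathbb{R}^{d_i}$ with $Q_{1}\otimes_{\pi}\cdots\otimes_{\pi}Q_{l}\subseteq Q\subseteq Q_{1}\otimes_{\epsilon}\cdots\otimes_{\epsilon}Q_{l}$. *)

theory Defs
  imports "HOL-Analysis.Analysis" "HOL-Library.Function_Algebras"
begin

text \<open>The pointwise real vector space structure on functions, so that \<^const>\<open>convex\<close> and
  \<^const>\<open>hull\<close> apply to coordinate vectors.\<close>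

instantiation "fun" :: (type, real_vector) real_vector
begin

definition scaleR_fun :: "real \<Rightarrow> ('a \<Rightarrow> 'b) \<Rightarrow> 'a \<Rightarrow> 'b" where
  "scaleR_fun c f = (\<lambda>x. c *\<^sub>R f x)"

instance
  by standard (auto simp: scaleR_fun_def plus_fun_def algebra_simps)

end

text \<open>Since the dimensions \<open>d\<^sub>1, \<dots>, d\<^sub>l\<close> are arbitrary numbers, the spaces are carriers rather than
  types. For a finite index set \<open>I\<close>, the space \<open>\<real>\<^sup>I\<close> consists of the functions vanishing outside
  \<open>I\<close>; its topology is the subspace topology of the product topology, as in
  \<^const>\<open>Euclidean_space\<close>. By \<open>openin_coord_space_iff\<close> below it is the topology of the norm
  induced by \<open>coord_inner\<close>. Both \<open>\<real>\<^bsup>d\<^esup>\<close> (with \<open>I = {..<d}\<close>) and the tensor product (with \<open>I\<close> the set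
  of multi-indices) are of this form.\<close>

definition coord_space :: "'i set \<Rightarrow> ('i \<Rightarrow> real) set" where
  "coord_space I = {x. \<forall>i. i \<notin> I \<longrightarrow> x i = 0}"

definition coord_inner :: "'i set \<Rightarrow> ('i \<Rightarrow> real) \<Rightarrow> ('i \<Rightarrow> real) \<Rightarrow> real" where
  "coord_inner I x y = (\<Sum>i\<in>I. x i * y i)"

definition convex_body :: "'i set \<Rightarrow> ('i \<Rightarrow> real) set \<Rightarrow> bool" where
  "convex_body I K \<longleftrightarrow> K \<subseteq> coord_space I \<and> compact K \<and> convex K \<and>
     (top_of_set (coord_space I)) interior_of K \<noteq> {}"

definition symmetric_body :: "'i set \<Rightarrow> ('i \<Rightarrow> real) set \<Rightarrow> bool" where
  "symmetric_body I K \<longleftrightarrow> convex_body I K \<and> K = uminus ` K"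

text \<open>The supremum is taken in \<^typ>\<open>ereal\<close>, so it is \<open>\<infinity>\<close> when unbounded.\<close>

definition polar_set :: "'i set \<Rightarrow> ('i \<Rightarrow> real) set \<Rightarrow> ('i \<Rightarrow> real) set" where
  "polar_set I C = {y \<in> coord_space I. (SUP x\<in>C. ereal \<bar>coord_inner I x y\<bar>) \<le> 1}"

definition multi_indices :: "nat \<Rightarrow> (nat \<Rightarrow> nat) \<Rightarrow> (nat \<Rightarrow> nat) set" where
  "multi_indices l d = (\<Pi>\<^sub>E i\<in>{1..l}. {..<d i})"

text \<open>The tensor product of \<open>\<real>\<^bsup>d 1\<^esup>, \<dots>, \<real>\<^bsup>d l\<^esup>\<close> is \<open>coord_space (multi_indices l d)\<close>. The lemmas
  \<open>coord_inner_tensor\<close> and \<open>tensor_expansion\<close> below show that \<open>coord_inner (multi_indices l d)\<close>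
  is the scalar product determined by the standard ones on elementary tensors.\<close>

definition tensor :: "nat \<Rightarrow> (nat \<Rightarrow> nat) \<Rightarrow> (nat \<Rightarrow> nat \<Rightarrow> real) \<Rightarrow> (nat \<Rightarrow> nat) \<Rightarrow> real" where
  "tensor l d x = (\<lambda>k. if k \<in> multi_indices l d then \<Prod>i=1..l. x i (k i) else 0)"

definition proj_tensor ::
  "nat \<Rightarrow> (nat \<Rightarrow> nat) \<Rightarrow> (nat \<Rightarrow> (nat \<Rightarrow> real) set) \<Rightarrow> ((nat \<Rightarrow> nat) \<Rightarrow> real) set" where
  "proj_tensor l d Q = convex hull {tensor l d x |x. \<forall>i\<in>{1..l}. x i \<in> Q i}"

definition inj_tensor ::
  "nat \<Rightarrow> (nat \<Rightarrow> nat) \<Rightarrow> (nat \<Rightarrow> (nat \<Rightarrow> real) set) \<Rightarrow> ((nat \<Rightarrow> nat) \<Rightarrow> real) set" where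
  "inj_tensor l d Q =
     polar_set (multi_indices l d) (proj_tensor l d (\<lambda>i. polar_set {..<d i} (Q i)))"

definition tensor_bodies ::
  "nat \<Rightarrow> (nat \<Rightarrow> nat) \<Rightarrow> (nat \<Rightarrow> (nat \<Rightarrow> real) set) \<Rightarrow> ((nat \<Rightarrow> nat) \<Rightarrow> real) set set" where
  "tensor_bodies l d Q = {K. symmetric_body (multi_indices l d) K \<and>
     proj_tensor l d Q \<subseteq> K \<and> K \<subseteq> inj_tensor l d Q}"

lemma Euclidean_space_eq_coord_space: "Euclidean_space n = top_of_set (coord_space {..<n})"
  unfolding Euclidean_space_def coord_space_def euclidean_product_topology
  by (simp add: not_less)

lemma finite_multi_indices: "finite (multi_indices l d)"
  unfolding multi_indices_def by (intro finite_PiE) auto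

lemma openin_coord_space_iff:
  fixes I :: "'i set" and U :: "('i \<Rightarrow> real) set"
  assumes "finite I"
  shows "openin (top_of_set (coord_space I)) U \<longleftrightarrow>
    U \<subseteq> coord_space I \<and>
    (\<forall>x\<in>U. \<exists>e>0. \<forall>y\<in>coord_space I. sqrt (coord_inner I (y - x) (y - x)) < e \<longrightarrow> y \<in> U)"
proof (intro iffI conjI ballI)
  assume op: "openin (top_of_set (coord_space I)) U"
  then show "U \<subseteq> coord_space I" by (simp add: openin_subset openin_imp_subset)
  fix x assume x: "x \<in> U"
  from op obtain T where T: "open T" "U = coord_space I \<inter> T" by (auto simp: openin_open)
  with x have "x \<in> T" by auto
  from product_topology_open_contains_basis[OF T(1)[unfolded open_fun_def] this]
  obtain X where X: "x \<in> Pi\<^sub>E UNIV X" "\<And>i. openin euclidean (X i)"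
      "Pi\<^sub>E UNIV X \<subseteq> T"
    by auto
  have "\<exists>e>0. ball (x i) e \<subseteq> X i" for i
    using X(1) X(2)[of i] open_contains_ball[of "X i"] by (auto simp: PiE_def Pi_def)
  then obtain e where e: "\<And>i. e i > 0" "\<And>i. ball (x i) (e i) \<subseteq> X i" by metis
  define d where "d = Min (insert 1 (e ` I))"
  have d: "d > 0" "\<And>i. i \<in> I \<Longrightarrow> d \<le> e i"
    using assms e(1) by (auto simp: d_def)
  have "y \<in> U" if y: "y \<in> coord_space I" and le: "sqrt (coord_inner I (y - x) (y - x)) < d" for y
  proof -
    have "y i \<in> X i" for i
    proof (cases "i \<in> I")
      case True
      have "(y i - x i)\<^sup>2 \<le> coord_inner I (y - x) (y - x)"
        unfolding coord_inner_def power2_eq_square[symmetric]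
        using member_le_sum[OF True, of "\<lambda>i. ((y - x) i)\<^sup>2"] assms by simp
      then have "\<bar>y i - x i\<bar> < e i"
        using le d(2)[OF True] real_le_rsqrt
        by (metis (no_types) order_le_less_trans order_less_le_trans power2_abs)
      then have "y i \<in> ball (x i) (e i)" by (simp add: dist_real_def abs_minus_commute)
      then show ?thesis using e(2) by blast
    next
      case False
      have "x \<in> coord_space I" using x T by auto
      then have "y i = x i" using False y by (simp add: coord_space_def)
      then show ?thesis using X(1) by (auto simp: PiE_def Pi_def)
    qed
    then have "y \<in> T" using X(3) by (auto simp: PiE_def Pi_def)
    then show ?thesis using T y by auto
  qed
  then show "\<exists>e>0. \<forall>y\<in>coord_space I. sqrt (coord_inner I (y - x) (y - x)) < e \<longrightarrow> y \<in> U"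
    using d(1) by blast
next
  assume R: "U \<subseteq> coord_space I \<and>
    (\<forall>x\<in>U. \<exists>e>0. \<forall>y\<in>coord_space I. sqrt (coord_inner I (y - x) (y - x)) < e \<longrightarrow> y \<in> U)"
  have cont: "continuous_on UNIV (\<lambda>y. sqrt (coord_inner I (y - x) (y - x)))" for x :: "'i \<Rightarrow> real"
    unfolding coord_inner_def fun_diff_def
    by (intro continuous_intros continuous_on_product_coordinates)
  have "\<exists>T. open T \<and> x \<in> T \<and> coord_space I \<inter> T \<subseteq> U" if x: "x \<in> U" for x
  proof -
    from R x obtain e where e: "e > 0"
      "\<And>y. y \<in> coord_space I \<Longrightarrow> sqrt (coord_inner I (y - x) (y - x)) < e \<Longrightarrow> y \<in> U" by blast
    have "open {y. sqrt (coord_inner I (y - x) (y - x)) < e}"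
      by (intro open_Collect_less cont continuous_on_const)
    moreover have "sqrt (coord_inner I (x - x) (x - x)) < e"
      using e(1) by (simp add: coord_inner_def)
    ultimately show ?thesis using e(2) by (intro exI[of _ "{y. sqrt (coord_inner I (y - x) (y - x)) < e}"]) auto
  qed
  then obtain T where T: "\<And>x. x \<in> U \<Longrightarrow> open (T x) \<and> x \<in> T x \<and> coord_space I \<inter> T x \<subseteq> U"
    by metis
  then have "U = coord_space I \<inter> (\<Union>x\<in>U. T x)" using R by blast
  moreover have "open (\<Union>x\<in>U. T x)" using T by auto
  ultimately show "openin (top_of_set (coord_space I)) U" by (auto simp: openin_open)
qed

lemma prod_sum_multi_indices:
  fixes f :: "nat \<Rightarrow> nat \<Rightarrow> real"
  shows "(\<Prod>i=1..l. \<Sum>j<d i. f i j) = (\<Sum>k\<in>multi_indices l d. \<Prod>i=1..l. f i (k i))"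
  unfolding multi_indices_def by (rule prod_sum_PiE) auto

lemma coord_inner_tensor:
  "coord_inner (multi_indices l d) (tensor l d x) (tensor l d y) =
     (\<Prod>i=1..l. coord_inner {..<d i} (x i) (y i))"
  unfolding coord_inner_def prod_sum_multi_indices
  by (intro sum.cong) (auto simp: tensor_def prod.distrib)

lemma tensor_expansion:
  assumes "z \<in> coord_space (multi_indices l d)"
  shows "z = (\<Sum>k\<in>multi_indices l d. z k *\<^sub>R tensor l d (\<lambda>i j. if j = k i then 1 else 0))"
proof
  fix m
  have eq: "tensor l d (\<lambda>i j. if j = k i then 1 else 0) m = (if k = m then 1 else 0)"
    if k: "k \<in> multi_indices l d" for k
  proof (cases "k = m")
    case True
    then show ?thesis using k by (simp add: tensor_def)
  next
    case False
    have "\<exists>i\<in>{1..l}. m i \<noteq> k i" if "m \<in> multi_indices l d"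
      using False k that PiE_ext unfolding multi_indices_def by metis
    then show ?thesis using False by (auto simp: tensor_def intro!: prod_zero)
  qed
  have sumapp: "(sum f A) m = (\<Sum>k\<in>A. f k m)" for f :: "(nat \<Rightarrow> nat) \<Rightarrow> (nat \<Rightarrow> nat) \<Rightarrow> real" and A
    by (induction A rule: infinite_finite_induct) auto
  have "(\<Sum>k\<in>multi_indices l d. z k *\<^sub>R tensor l d (\<lambda>i j. if j = k i then 1 else 0)) m =
      (\<Sum>k\<in>multi_indices l d. if k = m then z k else 0)"
    unfolding sumapp by (intro sum.cong) (auto simp: scaleR_fun_def eq)
  also have "\<dots> = z m"
    using assms by (auto simp: coord_space_def finite_multi_indices)
  finally show "z m = (\<Sum>k\<in>multi_indices l d. z k *\<^sub>R tensor l d (\<lambda>i j. if j = k i then 1 else 0)) m"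
    by simp
qed

end

theory Submission
  imports Defs
begin

text \<open>Write \<open>A\<degree>\<close> for the polar of \<open>A\<close>. Testing \<open>P\<^sub>1 \<otimes>\<^sub>\<pi> \<cdots> \<otimes>\<^sub>\<pi> P\<^sub>l \<subseteq> K \<subseteq> Q\<^sub>1 \<otimes>\<^sub>\<epsilon> \<cdots> \<otimes>\<^sub>\<epsilon> Q\<^sub>l\<close> on elementary
  tensors shows that \<open>\<Prod>\<^sub>i \<bar>\<langle>x\<^sup>i, y\<^sup>i\<rangle>\<bar> \<le> 1\<close> whenever \<open>x\<^sup>i \<in> P\<^sub>i\<close> and \<open>y\<^sup>i \<in> Q\<^sub>i\<degree>\<close>. The factors vary
  independently, so the numbers \<open>a\<^sub>i = sup {\<bar>\<langle>x, y\<rangle>\<bar> : x \<in> P\<^sub>i, y \<in> Q\<^sub>i\<degree>}\<close> still satisfy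
  \<open>\<Prod>\<^sub>i a\<^sub>i \<le> 1\<close> (\<open>prod_Sup_le_1\<close>), and by the bipolar theorem (\<open>symmetric_body_bipolar\<close>) \<open>a\<^sub>i\<close> is a factor
  with \<open>P\<^sub>i \<subseteq> a\<^sub>i Q\<^sub>i\<close>. Exchanging the roles of \<open>P\<close> and \<open>Q\<close> gives \<open>b\<^sub>i\<close> with \<open>Q\<^sub>i \<subseteq> b\<^sub>i P\<^sub>i\<close> and
  \<open>\<Prod>\<^sub>i b\<^sub>i \<le> 1\<close>.

  Now \<open>P\<^sub>i \<subseteq> a\<^sub>i b\<^sub>i P\<^sub>i\<close> forces \<open>a\<^sub>i b\<^sub>i \<ge> 1\<close>, because a body is bounded and not \<open>{0}\<close>
  (\<open>inclusion_factors_ge_1\<close>). As the product of all the \<open>a\<^sub>i b\<^sub>i\<close> is at most \<open>1\<close>, each of them equals \<open>1\<close>.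
  Hence \<open>P\<^sub>i \<subseteq> a\<^sub>i Q\<^sub>i \<subseteq> a\<^sub>i b\<^sub>i P\<^sub>i = P\<^sub>i\<close>, and both products, which are at most \<open>1\<close> and multiply to
  \<open>1\<close>, equal \<open>1\<close>.\<close>

section \<open>The scalar product and polars\<close>

lemma coord_inner_commute: "coord_inner I x y = coord_inner I y x"
  by (simp add: coord_inner_def mult.commute)

lemma coord_inner_scaleR_right: "coord_inner I x (c *\<^sub>R y) = c * coord_inner I x y"
  by (simp add: coord_inner_def scaleR_fun_def sum_distrib_left algebra_simps)

lemma coord_inner_scaleR_left: "coord_inner I (c *\<^sub>R x) y = c * coord_inner I x y"
  by (simp add: coord_inner_def scaleR_fun_def sum_distrib_left algebra_simps)

lemma coord_inner_diff_left: "coord_inner I (x - y) z = coord_inner I x z - coord_inner I y z"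
  by (simp add: coord_inner_def sum_subtractf algebra_simps)

lemma coord_inner_diff_right: "coord_inner I z (x - y) = coord_inner I z x - coord_inner I z y"
  by (simp add: coord_inner_def sum_subtractf algebra_simps)

lemma coord_inner_minus_left: "coord_inner I (- x) y = - coord_inner I x y"
  by (simp add: coord_inner_def sum_negf)

lemma coord_inner_unit_right:
  assumes "finite I" "j \<in> I"
  shows "coord_inner I x (\<lambda>i. if i = j then c else 0) = c * x j"
proof -
  have "coord_inner I x (\<lambda>i. if i = j then c else 0) = (\<Sum>i\<in>I. if i = j then c * x i else 0)"
    unfolding coord_inner_def by (intro sum.cong) auto
  then show ?thesis using assms by simp
qed

lemma polar_set_iff:
  "y \<in> polar_set I C \<longleftrightarrow> y \<in> coord_space I \<and> (\<forall>x\<in>C. \<bar>coord_inner I x y\<bar> \<le> 1)"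
  by (simp add: polar_set_def SUP_le_iff)

section \<open>Separation and the bipolar theorem\<close>

text \<open>The nearest point \<open>x0\<close> of \<open>K\<close> to \<open>z\<close> yields the separating direction \<open>z - x0\<close>.\<close>

lemma compact_convex_separation:
  assumes fin: "finite I" and K: "K \<subseteq> coord_space I" "compact K" "convex K" "K \<noteq> {}"
    and z: "z \<in> coord_space I" "z \<notin> K"
  obtains v x0 where "v \<in> coord_space I" "x0 \<in> K"
    "\<And>x. x \<in> K \<Longrightarrow> coord_inner I x v \<le> coord_inner I x0 v"
    "coord_inner I x0 v < coord_inner I z v"
proof -
  have "continuous_on K (\<lambda>x. coord_inner I (z - x) (z - x))"
    unfolding coord_inner_def fun_diff_def
    by (intro continuous_intros continuous_on_subset[OF continuous_on_product_coordinates]) auto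
  from continuous_attains_inf[OF K(2,4) this]
  obtain x0 where x0: "x0 \<in> K"
    "\<And>x. x \<in> K \<Longrightarrow> coord_inner I (z - x0) (z - x0) \<le> coord_inner I (z - x) (z - x)"
    by blast
  define v where "v = z - x0"
  have v: "v \<in> coord_space I"
    using z x0 K by (auto simp: v_def coord_space_def subset_iff)
  have max: "coord_inner I x v \<le> coord_inner I x0 v" if x: "x \<in> K" for x
  proof (rule ccontr)
    define w where "w = x - x0"
    define p where "p = coord_inner I w v"
    define n where "n = coord_inner I w w"
    assume "\<not> ?thesis"
    then have p: "p > 0" by (simp add: p_def w_def coord_inner_diff_left)
    have n: "n \<ge> 0" by (simp add: n_def coord_inner_def sum_nonneg)
    \<comment> \<open>The squared distance from \<open>z\<close> decreases strictly on moving from \<open>x0\<close> towards \<open>x\<close> by a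
      fraction \<open>t\<close> with \<open>t * n < 2 * p\<close>.\<close>
    define t where "t = p / (p + n)"
    have t: "0 < t" "t \<le> 1" "t * n < p"
      using p n by (auto simp: t_def field_simps)
    have "(1 - t) *\<^sub>R x0 + t *\<^sub>R x \<in> K"
      using K(3) x x0(1) t by (intro convexD) auto
    moreover have "z - ((1 - t) *\<^sub>R x0 + t *\<^sub>R x) = v - t *\<^sub>R w"
      by (simp add: v_def w_def algebra_simps)
    ultimately have "coord_inner I v v \<le> coord_inner I (v - t *\<^sub>R w) (v - t *\<^sub>R w)"
      using x0(2) v_def by metis
    also have "\<dots> = coord_inner I v v - 2 * t * p + t * (t * n)"
      by (simp add: coord_inner_diff_left coord_inner_diff_right coord_inner_scaleR_left
          coord_inner_scaleR_right p_def n_def coord_inner_commute[of I v w] algebra_simps)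
    finally have "t * (2 * p) \<le> t * (t * n)" by simp
    then show False using t p by simp
  qed
  have "v \<noteq> 0" using z x0 by (auto simp: v_def)
  then obtain j where j: "v j \<noteq> 0" by (auto simp: fun_eq_iff)
  then have "j \<in> I" using v by (auto simp: coord_space_def)
  then have "0 < coord_inner I v v"
    unfolding coord_inner_def using fin j by (intro sum_pos2[of I j]) (auto simp: zero_less_mult_iff)
  then have "coord_inner I x0 v < coord_inner I z v"
    by (simp add: v_def coord_inner_diff_left)
  with that v x0(1) max show ?thesis by blast
qed

lemma symmetric_body_coord_ne_0:
  assumes fin: "finite I" and K: "symmetric_body I K" and j: "j \<in> I"
  shows "\<exists>x\<in>K. x j \<noteq> 0"
proof (rule ccontr)
  assume neg: "\<not> ?thesis"
  let ?U = "(top_of_set (coord_space I)) interior_of K"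
  have "openin (top_of_set (coord_space I)) ?U" by simp
  note U = this[unfolded openin_coord_space_iff[OF fin]]
  have sub: "?U \<subseteq> K" by (rule interior_of_subset)
  from K obtain x where x: "x \<in> ?U" by (auto simp: symmetric_body_def convex_body_def)
  with U obtain e where e: "e > 0"
    "\<And>y. y \<in> coord_space I \<Longrightarrow> sqrt (coord_inner I (y - x) (y - x)) < e \<Longrightarrow> y \<in> ?U"
    by blast
  define u where "u = (\<lambda>i. if i = j then e / 2 else 0)"
  have "coord_inner I u u = (e / 2)\<^sup>2"
    using coord_inner_unit_right[OF fin j, of u "e / 2"] by (simp add: u_def power2_eq_square)
  then have "sqrt (coord_inner I ((x + u) - x) ((x + u) - x)) < e"
    using e(1) by simp
  moreover have "x + u \<in> coord_space I"
    using U x j by (auto simp: coord_space_def u_def)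
  ultimately have "x + u \<in> K" using e(2) sub by blast
  then have "x j + e / 2 = 0" using neg by (auto simp: u_def)
  moreover have "x j = 0" using neg x sub by blast
  ultimately show False using e(1) by simp
qed

text \<open>The half of the bipolar theorem that needs separation; symmetry of \<open>K\<close> turns the one-sided
  bound from the separating functional into a bound on its absolute value.\<close>

lemma symmetric_body_bipolar:
  assumes fin: "finite I" and K: "symmetric_body I K" and z: "z \<in> coord_space I"
    and le: "\<And>y. y \<in> polar_set I K \<Longrightarrow> \<bar>coord_inner I z y\<bar> \<le> 1"
  shows "z \<in> K"
proof (rule ccontr)
  assume nz: "z \<notin> K"
  have cb: "K \<subseteq> coord_space I" "compact K" "convex K"
      "(top_of_set (coord_space I)) interior_of K \<noteq> {}" and sym: "K = uminus ` K"
    using K by (auto simp: symmetric_body_def convex_body_def)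
  have "K \<noteq> {}" using cb(4) by (auto simp: interior_of_empty)
  from compact_convex_separation[OF fin cb(1-3) this z nz]
  obtain v x0 where v: "v \<in> coord_space I" "x0 \<in> K"
    "\<And>x. x \<in> K \<Longrightarrow> coord_inner I x v \<le> coord_inner I x0 v"
    "coord_inner I x0 v < coord_inner I z v" by metis
  define m where "m = coord_inner I x0 v"
  have abs: "\<bar>coord_inner I x v\<bar> \<le> m" if "x \<in> K" for x
  proof -
    have "- x \<in> K" using that sym by blast
    then show ?thesis using v(3)[OF that] v(3)[of "- x"]
      by (simp add: m_def coord_inner_minus_left)
  qed
  have m: "0 \<le> m" using abs[OF v(2)] by linarith
  \<comment> \<open>Any \<open>s\<close> strictly between \<open>m\<close> and \<open>\<langle>z, v\<rangle>\<close> makes \<open>v / s\<close> a point of the polar that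
    excludes \<open>z\<close>; the midpoint is also positive.\<close>
  define s where "s = (m + coord_inner I z v) / 2"
  have s: "m < s" "s < coord_inner I z v" "0 < s" using v(4) m by (auto simp: s_def m_def)
  have "(1 / s) *\<^sub>R v \<in> polar_set I K"
    unfolding polar_set_iff
  proof (intro conjI ballI)
    show "(1 / s) *\<^sub>R v \<in> coord_space I" using v by (auto simp: coord_space_def scaleR_fun_def)
    fix x assume "x \<in> K"
    with abs[of x] s show "\<bar>coord_inner I x ((1 / s) *\<^sub>R v)\<bar> \<le> 1"
      by (simp add: coord_inner_scaleR_right abs_mult)
  qed
  from le[OF this] s show False by (simp add: coord_inner_scaleR_right)
qed

section \<open>Inclusion factors from tensor inclusions\<close>

text \<open>A small enough multiple of a coordinate functional lies in \<open>B\<degree>\<close>, and it does not vanish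
  on \<open>A\<close> because \<open>A\<close> has interior points.\<close>

lemma symmetric_body_pairing_pos:
  assumes fin: "finite I" and "I \<noteq> {}" and A: "symmetric_body I A" and B: "symmetric_body I B"
  shows "\<exists>x\<in>A. \<exists>y\<in>polar_set I B. 0 < \<bar>coord_inner I x y\<bar>"
proof -
  obtain j where j: "j \<in> I" using \<open>I \<noteq> {}\<close> by blast
  obtain x where x: "x \<in> A" "x j \<noteq> 0" using symmetric_body_coord_ne_0[OF fin A j] by blast
  have "compact ((\<lambda>x. x j) ` B)"
    using B by (intro compact_continuous_image continuous_on_subset[OF continuous_on_product_coordinates])
      (auto simp: symmetric_body_def convex_body_def)
  then obtain M where M: "M > 0" "\<And>x. x \<in> B \<Longrightarrow> \<bar>x j\<bar> \<le> M"
    using compact_imp_bounded bounded_pos[of "(\<lambda>x. x j) ` B"] by auto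
  define y where "y = (\<lambda>i. if i = j then 1 / M else 0)"
  have y: "coord_inner I x y = x j / M" for x
    using coord_inner_unit_right[OF fin j, of x "1 / M"] by (simp add: y_def)
  have "y \<in> polar_set I B"
    using M j by (auto simp: polar_set_iff y) (auto simp: y_def coord_space_def)
  moreover have "0 < \<bar>coord_inner I x y\<bar>" using x M(1) by (simp add: y)
  ultimately show ?thesis using x(1) by blast
qed

text \<open>Fixing positive elements in the other factors shows that each \<open>S i\<close> is bounded.
  The bound on the product of suprema then follows by approximating all suprema at once.\<close>

lemma prod_Sup_le_1:
  fixes S :: "'i \<Rightarrow> real set"
  assumes fin: "finite I"
    and pos: "\<And>i. i \<in> I \<Longrightarrow> \<exists>s\<in>S i. 0 < s"
    and le: "\<And>s. (\<And>i. i \<in> I \<Longrightarrow> s i \<in> S i) \<Longrightarrow> (\<Prod>i\<in>I. s i) \<le> 1"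
  shows "\<forall>i\<in>I. bdd_above (S i)" and "(\<Prod>i\<in>I. Sup (S i)) \<le> 1"
proof -
  from pos obtain p where p: "\<And>i. i \<in> I \<Longrightarrow> p i \<in> S i \<and> 0 < p i" by metis
  show bdd: "\<forall>i\<in>I. bdd_above (S i)"
  proof
    fix j assume j: "j \<in> I"
    have rest: "0 < (\<Prod>i\<in>I - {j}. p i)" using p by (intro prod_pos) auto
    have "s \<le> 1 / (\<Prod>i\<in>I - {j}. p i)" if s: "s \<in> S j" for s
    proof -
      have "(\<Prod>i\<in>I. (p(j := s)) i) \<le> 1" using p s by (intro le) auto
      moreover have "(\<Prod>i\<in>I. (p(j := s)) i) = s * (\<Prod>i\<in>I - {j}. p i)"
        by (subst prod.remove[OF fin j]) (auto intro!: prod.cong)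
      ultimately show ?thesis using rest by (simp add: field_simps)
    qed
    then show "bdd_above (S j)" by (rule bdd_aboveI)
  qed
  have "\<exists>f. (\<forall>n. f n \<in> S i) \<and> f \<longlonglongrightarrow> Sup (S i)" if "i \<in> I" for i
    using closure_contains_Sup[of "S i"] bdd p[OF that] that
    unfolding closure_sequential by auto
  then obtain f where f: "\<And>i n. i \<in> I \<Longrightarrow> f i n \<in> S i" "\<And>i. i \<in> I \<Longrightarrow> f i \<longlonglongrightarrow> Sup (S i)"
    by metis
  have "(\<lambda>n. \<Prod>i\<in>I. f i n) \<longlonglongrightarrow> (\<Prod>i\<in>I. Sup (S i))"
    using f(2) by (intro tendsto_prod)
  then show "(\<Prod>i\<in>I. Sup (S i)) \<le> 1"
    by (rule LIMSEQ_le_const2) (use f(1) in \<open>auto intro!: le\<close>)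
qed

lemma pairing_bound_imp_subset_scaled:
  assumes fin: "finite I" and A: "A \<subseteq> coord_space I" and B: "symmetric_body I B" and a: "0 < a"
    and le: "\<And>x y. x \<in> A \<Longrightarrow> y \<in> polar_set I B \<Longrightarrow> \<bar>coord_inner I x y\<bar> \<le> a"
  shows "A \<subseteq> (\<lambda>x. a *\<^sub>R x) ` B"
proof
  fix x assume x: "x \<in> A"
  have "(1 / a) *\<^sub>R x \<in> B"
  proof (rule symmetric_body_bipolar[OF fin B])
    show "(1 / a) *\<^sub>R x \<in> coord_space I"
      using x A by (auto simp: coord_space_def scaleR_fun_def)
    fix y assume "y \<in> polar_set I B"
    from le[OF x this] a show "\<bar>coord_inner I ((1 / a) *\<^sub>R x) y\<bar> \<le> 1"
      by (simp add: coord_inner_scaleR_left abs_mult)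
  qed
  then show "x \<in> (\<lambda>x. a *\<^sub>R x) ` B" using a by (intro image_eqI[of _ _ "(1 / a) *\<^sub>R x"]) auto
qed

lemma proj_subset_inj_imp_prod_le_1:
  assumes sub: "proj_tensor l d A \<subseteq> inj_tensor l d B"
    and x: "\<And>i. i \<in> {1..l} \<Longrightarrow> x i \<in> A i"
    and y: "\<And>i. i \<in> {1..l} \<Longrightarrow> y i \<in> polar_set {..<d i} (B i)"
  shows "(\<Prod>i=1..l. \<bar>coord_inner {..<d i} (x i) (y i)\<bar>) \<le> 1"
proof -
  have "tensor l d x \<in> proj_tensor l d A"
    unfolding proj_tensor_def using x by (intro hull_inc) auto
  moreover have "tensor l d y \<in> proj_tensor l d (\<lambda>i. polar_set {..<d i} (B i))"
    unfolding proj_tensor_def using y by (intro hull_inc) auto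
  ultimately have "\<bar>coord_inner (multi_indices l d) (tensor l d y) (tensor l d x)\<bar> \<le> 1"
    using sub by (auto simp: inj_tensor_def polar_set_iff)
  then show ?thesis
    by (simp add: coord_inner_commute[of _ "tensor l d y"] coord_inner_tensor abs_prod)
qed

text \<open>The quantitative half of the argument: the two sides of the sandwich, taken from different
  families of bodies, still bound the first family by the second one, up to dilations whose
  product is at most \<open>1\<close>.\<close>

lemma proj_subset_inj_imp_inclusion_factors:
  assumes d: "\<And>i. i \<in> {1..l} \<Longrightarrow> 1 \<le> d i"
    and A: "\<And>i. i \<in> {1..l} \<Longrightarrow> symmetric_body {..<d i} (A i)"
    and B: "\<And>i. i \<in> {1..l} \<Longrightarrow> symmetric_body {..<d i} (B i)"
    and sub: "proj_tensor l d A \<subseteq> inj_tensor l d B"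
  obtains a :: "nat \<Rightarrow> real" where "\<And>i. i \<in> {1..l} \<Longrightarrow> 0 < a i" "(\<Prod>i=1..l. a i) \<le> 1"
    "\<And>i. i \<in> {1..l} \<Longrightarrow> A i \<subseteq> (\<lambda>x. a i *\<^sub>R x) ` B i"
proof -
  define S where "S i = {\<bar>coord_inner {..<d i} x y\<bar> |x y. x \<in> A i \<and> y \<in> polar_set {..<d i} (B i)}" for i
  define a where "a i = Sup (S i)" for i
  have pos: "\<exists>s\<in>S i. 0 < s" if i: "i \<in> {1..l}" for i
  proof -
    have "{..<d i} \<noteq> {}" using d[OF i] by (auto simp: lessThan_empty_iff)
    from symmetric_body_pairing_pos[OF finite_lessThan this A[OF i] B[OF i]]
    show ?thesis unfolding S_def by blast
  qed
  have le: "(\<Prod>i=1..l. s i) \<le> 1" if s: "\<And>i. i \<in> {1..l} \<Longrightarrow> s i \<in> S i" for s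
  proof -
    from s have "\<forall>i\<in>{1..l}. \<exists>x y. x \<in> A i \<and> y \<in> polar_set {..<d i} (B i) \<and>
        s i = \<bar>coord_inner {..<d i} x y\<bar>"
      unfolding S_def by blast
    then obtain x y where xy: "\<And>i. i \<in> {1..l} \<Longrightarrow> x i \<in> A i \<and> y i \<in> polar_set {..<d i} (B i) \<and>
        s i = \<bar>coord_inner {..<d i} (x i) (y i)\<bar>"
      unfolding bchoice_iff by blast
    then have "(\<Prod>i=1..l. s i) = (\<Prod>i=1..l. \<bar>coord_inner {..<d i} (x i) (y i)\<bar>)"
      by (intro prod.cong) auto
    then show ?thesis using proj_subset_inj_imp_prod_le_1[OF sub] xy by simp
  qed
  have Sup: "\<forall>i\<in>{1..l}. bdd_above (S i)" "(\<Prod>i=1..l. Sup (S i)) \<le> 1"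
    by (rule prod_Sup_le_1; use pos le in blast)+
  have upper: "s \<le> a i" if "i \<in> {1..l}" "s \<in> S i" for i s
    unfolding a_def using Sup(1) that by (intro cSup_upper) auto
  have a_pos: "0 < a i" if i: "i \<in> {1..l}" for i
    using pos[OF i] upper[OF i] by force
  have "A i \<subseteq> (\<lambda>x. a i *\<^sub>R x) ` B i" if i: "i \<in> {1..l}" for i
  proof (rule pairing_bound_imp_subset_scaled[OF _ _ B[OF i] a_pos[OF i]])
    show "A i \<subseteq> coord_space {..<d i}"
      using A[OF i] by (simp add: symmetric_body_def convex_body_def)
    fix x y assume "x \<in> A i" "y \<in> polar_set {..<d i} (B i)"
    then have "\<bar>coord_inner {..<d i} x y\<bar> \<in> S i" unfolding S_def by blast
    then show "\<bar>coord_inner {..<d i} x y\<bar> \<le> a i" by (rule upper[OF i])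
  qed simp
  with that[of a] a_pos Sup(2) show ?thesis unfolding a_def by blast
qed

section \<open>Rigidity of the factors\<close>

text \<open>Since \<open>A \<subseteq> a b A\<close>, a coordinate whose largest absolute value on \<open>A\<close> is \<open>m > 0\<close>
  satisfies \<open>m \<le> a b m\<close>.\<close>

lemma inclusion_factors_ge_1:
  assumes fin: "finite I" and "I \<noteq> {}" and A: "symmetric_body I A"
    and ab: "0 < a" "0 < b" "A \<subseteq> (\<lambda>x. a *\<^sub>R x) ` B" "B \<subseteq> (\<lambda>x. b *\<^sub>R x) ` A"
  shows "1 \<le> a * b"
proof -
  obtain j where j: "j \<in> I" using \<open>I \<noteq> {}\<close> by blast
  obtain x1 where x1: "x1 \<in> A" "x1 j \<noteq> 0" using symmetric_body_coord_ne_0[OF fin A j] by blast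
  have "compact A" "A \<noteq> {}" using A x1 by (auto simp: symmetric_body_def convex_body_def)
  moreover have "continuous_on A (\<lambda>x. \<bar>x j\<bar>)"
    by (intro continuous_intros continuous_on_subset[OF continuous_on_product_coordinates]) auto
  ultimately have "\<exists>x\<in>A. \<forall>y\<in>A. \<bar>y j\<bar> \<le> \<bar>x j\<bar>"
    by (rule continuous_attains_sup)
  then obtain x where x: "x \<in> A" "\<And>y. y \<in> A \<Longrightarrow> \<bar>y j\<bar> \<le> \<bar>x j\<bar>"
    by blast
  obtain q where q: "q \<in> B" "x = a *\<^sub>R q" using ab(3) x(1) by blast
  obtain p where p: "p \<in> A" "q = b *\<^sub>R p" using ab(4) q(1) by blast
  have "\<bar>x j\<bar> = a * b * \<bar>p j\<bar>" using ab by (simp add: q(2) p(2) scaleR_fun_def abs_mult)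
  also have "\<dots> \<le> a * b * \<bar>x j\<bar>" using x(2)[OF p(1)] ab by simp
  finally have "1 * \<bar>x j\<bar> \<le> a * b * \<bar>x j\<bar>" by simp
  moreover have "0 < \<bar>x j\<bar>" using x(2)[OF x1(1)] x1(2) by linarith
  ultimately show ?thesis by (rule mult_right_le_imp_le)
qed

lemma prod_le_1_imp_eq_1:
  fixes f :: "'i \<Rightarrow> real"
  assumes fin: "finite I" and ge: "\<And>i. i \<in> I \<Longrightarrow> 1 \<le> f i" and le: "(\<Prod>i\<in>I. f i) \<le> 1"
    and j: "j \<in> I"
  shows "f j = 1"
proof -
  have "1 \<le> (\<Prod>i\<in>I - {j}. f i)" using ge by (intro prod_ge_1) auto
  then have "f j * 1 \<le> f j * (\<Prod>i\<in>I - {j}. f i)" using ge[OF j] by (intro mult_left_mono) auto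
  also have "\<dots> = (\<Prod>i\<in>I. f i)" using prod.remove[OF fin j] by metis
  finally show ?thesis using le ge[OF j] by simp
qed

theorem proposition3p6:
  fixes l :: nat and d :: "nat \<Rightarrow> nat"
    and P Q :: "nat \<Rightarrow> (nat \<Rightarrow> real) set"
    and K :: "((nat \<Rightarrow> nat) \<Rightarrow> real) set"
  assumes "1 \<le> l"
    and "\<And>i. i \<in> {1..l} \<Longrightarrow> 1 \<le> d i"
    and "\<And>i. i \<in> {1..l} \<Longrightarrow> symmetric_body {..<d i} (P i)"
    and "\<And>i. i \<in> {1..l} \<Longrightarrow> symmetric_body {..<d i} (Q i)"
    and "K \<in> tensor_bodies l d P \<inter> tensor_bodies l d Q"
  shows "\<exists>c :: nat \<Rightarrow> real. (\<forall>i\<in>{1..l}. 0 < c i) \<and> (\<Prod>i=1..l. c i) = 1 \<and>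
    (\<forall>i\<in>{1..l}. P i = (\<lambda>x. c i *\<^sub>R x) ` Q i)"
proof -
  have PQ: "proj_tensor l d P \<subseteq> inj_tensor l d Q" and QP: "proj_tensor l d Q \<subseteq> inj_tensor l d P"
    using assms(5) by (auto simp: tensor_bodies_def)
  obtain a where a: "\<And>i. i \<in> {1..l} \<Longrightarrow> 0 < a i" "(\<Prod>i=1..l. a i) \<le> 1"
      "\<And>i. i \<in> {1..l} \<Longrightarrow> P i \<subseteq> (\<lambda>x. a i *\<^sub>R x) ` Q i"
    using proj_subset_inj_imp_inclusion_factors[OF assms(2,3,4) PQ] by blast
  obtain b where b: "\<And>i. i \<in> {1..l} \<Longrightarrow> 0 < b i" "(\<Prod>i=1..l. b i) \<le> 1"
      "\<And>i. i \<in> {1..l} \<Longrightarrow> Q i \<subseteq> (\<lambda>x. b i *\<^sub>R x) ` P i"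
    using proj_subset_inj_imp_inclusion_factors[OF assms(2,4,3) QP] by blast
  have pos: "0 < (\<Prod>i=1..l. a i)" "0 < (\<Prod>i=1..l. b i)"
    using a(1) b(1) by (auto intro!: prod_pos)
  have ge: "1 \<le> a i * b i" if i: "i \<in> {1..l}" for i
    by (rule inclusion_factors_ge_1[OF _ _ assms(3)[OF i] a(1)[OF i] b(1)[OF i] a(3)[OF i] b(3)[OF i]])
      (use assms(2)[OF i] in \<open>auto simp: lessThan_empty_iff\<close>)
  have "(\<Prod>i=1..l. a i * b i) \<le> 1"
    unfolding prod.distrib using a(2) b(2) pos by (intro mult_le_one) auto
  then have ab: "a i * b i = 1" if "i \<in> {1..l}" for i
    using prod_le_1_imp_eq_1[of "{1..l}" "\<lambda>i. a i * b i"] ge that by auto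
  have "(\<Prod>i=1..l. a i) * (\<Prod>i=1..l. b i) = 1"
    using ab by (simp flip: prod.distrib)
  moreover have "(\<Prod>i=1..l. a i) * (\<Prod>i=1..l. b i) \<le> (\<Prod>i=1..l. a i)"
    using b(2) pos by (intro mult_left_le) auto
  ultimately have prod: "(\<Prod>i=1..l. a i) = 1" using a(2) by simp
  have "P i = (\<lambda>x. a i *\<^sub>R x) ` Q i" if i: "i \<in> {1..l}" for i
  proof
    show "(\<lambda>x. a i *\<^sub>R x) ` Q i \<subseteq> P i"
    proof
      fix x assume "x \<in> (\<lambda>x. a i *\<^sub>R x) ` Q i"
      then obtain p where "p \<in> P i" "x = a i *\<^sub>R b i *\<^sub>R p" using b(3)[OF i] by blast
      then show "x \<in> P i" using ab[OF i] by simp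
    qed
  qed (rule a(3)[OF i])
  with a(1) prod show ?thesis by blast
qed

end
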